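(* Let $(s,t)\in\mathbb{Q}^2-\mathbb{Z}^2$. Then the function $f_{(s,t)}(\tau):=\wp(\tau,s\tau+t)$ on the upper half plane $\mathbb{H}$ is an elliptic modular form of weight $2$ with respect to $\Gamma_{(s,t)}$.
   Context: $\mathbb{H}=\{\tau\in\mathbb{C}\mid \operatorname{Im}\tau>0\}$. For a lattice $\Omega\subset\mathbb{C}$ (a $\mathbb{Z}$-module generated by two $\mathbb{R}$-linearly independent elements), the Weierstrass $\wp$-function is $$\wp(\Omega,z)=\frac{1}{z^2}+\sum_{\omega\in\Omega-\{0\}}\left(\frac{1}{(z-\omega)^2}-\frac{1}{\omega^2}\right),$$ and $\wp(\tau,z):=\wp(\tau\mathbb{Z}+\mathbb{Z},z)$ for $\tau\in\mathbb{H}$. For $(s,t)\in\mathbb{Q}^2$ and $A=\begin{pmatrix}a&b\\c&d\end{pmatrix}\in\mathrm{SL}(2,\mathbb{Z})$, $(s,t)A=(sa+tc,\,sb+td)$ is the product of a row vector and a matrix, and $$\Gamma_{(s,t)}:=\{A\in\mathrm{SL}(2,\mathbb{Z})\mid (s,t)A-(s,t)\in\mathbb{Z}^2\},$$ which contains the principal congruence subgroup $\Gamma(L)$, where $L$ is a common denominator of $s$ and $t$. An elliptic modular form of weight $k$ with respect to such a group $\Gamma$ is a holomorphic function $f$ on $\mathbb{H}$ with $f|_kA=f$ for all $A\in\Gamma$, where $(f|_kA)(\tau)=(c\tau+d)^{-k}f\left(\frac{a\tau+b}{c\tau+d}\right)$, and which is holomorphic at every cusp (equivalently, for every $A\in\mathrm{SL}(2,\mathbb{Z})$,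 $f|_kA$ is bounded on $\{\operatorname{Im}\tau>C\}$ for some $C>0$). *)

theory Defs
  imports "HOL-Complex_Analysis.Complex_Analysis" "HOL-Number_Theory.Cong"
begin

definition upper_half_plane :: "complex set" where
  "upper_half_plane = {\<tau>. Im \<tau> > 0}"

definition SL2Z :: "(int ^ 2 ^ 2) set" where
  "SL2Z = {A. det A = 1}"

definition principal_congruence_subgroup :: "int \<Rightarrow> (int ^ 2 ^ 2) set" where
  "principal_congruence_subgroup L =
     {A \<in> SL2Z. [A $ 1 $ 1 = 1] (mod L) \<and> [A $ 1 $ 2 = 0] (mod L) \<and>
                [A $ 2 $ 1 = 0] (mod L) \<and> [A $ 2 $ 2 = 1] (mod L)}"

definition row_times :: "rat \<times> rat \<Rightarrow> int ^ 2 ^ 2 \<Rightarrow> rat \<times> rat" where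
  "row_times v A =
     (fst v * of_int (A $ 1 $ 1) + snd v * of_int (A $ 2 $ 1),
      fst v * of_int (A $ 1 $ 2) + snd v * of_int (A $ 2 $ 2))"

definition Gamma_vec :: "rat \<times> rat \<Rightarrow> (int ^ 2 ^ 2) set" where
  "Gamma_vec v = {A \<in> SL2Z. row_times v A - v \<in> \<int> \<times> \<int>}"

definition is_lattice :: "complex set \<Rightarrow> bool" where
  "is_lattice \<Omega> \<longleftrightarrow>
     (\<exists>w1 w2. w1 \<noteq> w2 \<and> independent {w1, w2} \<and>
        \<Omega> = {of_int m * w1 + of_int n * w2 | m n. True})"

definition period_lattice :: "complex \<Rightarrow> complex set" where
  "period_lattice \<tau> = {of_int m * \<tau> + of_int n | m n. True}"

text \<open>
  The sum below is unordered; when \<open>\<Omega>\<close> is a lattice and \<open>z\<close> is not in \<open>\<Omega>\<close> it converges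
  absolutely. Only such arguments are meaningful: at lattice points the function
  takes a junk value, since division by zero yields zero.
\<close>

definition weierstrass_p :: "complex set \<Rightarrow> complex \<Rightarrow> complex" where
  "weierstrass_p \<Omega> z =
     1 / z ^ 2 + (\<Sum>\<^sub>\<infinity>\<omega>\<in>\<Omega> - {0}. 1 / (z - \<omega>) ^ 2 - 1 / \<omega> ^ 2)"

definition wp_tau :: "complex \<Rightarrow> complex \<Rightarrow> complex" where
  "wp_tau \<tau> z = weierstrass_p (period_lattice \<tau>) z"

definition division_value :: "rat \<times> rat \<Rightarrow> complex \<Rightarrow> complex" where
  "division_value v \<tau> = wp_tau \<tau> (of_rat (fst v) * \<tau> + of_rat (snd v))"

definition slash :: "int \<Rightarrow> int ^ 2 ^ 2 \<Rightarrow> (complex \<Rightarrow> complex) \<Rightarrow> complex \<Rightarrow> complex" where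
  "slash k A f \<tau> =
     (of_int (A $ 2 $ 1) * \<tau> + of_int (A $ 2 $ 2)) powi (- k) *
     f ((of_int (A $ 1 $ 1) * \<tau> + of_int (A $ 1 $ 2)) /
        (of_int (A $ 2 $ 1) * \<tau> + of_int (A $ 2 $ 2)))"

text \<open>
  The last conjunct is holomorphy at all cusps, in the form of boundedness of every
  \<open>f|\<^sub>kA\<close> near \<open>i\<infinity>\<close>. This is the right condition when \<open>\<Gamma>\<close> contains some
  \<open>\<Gamma>(L)\<close> with \<open>L > 0\<close>, which makes every \<open>f|\<^sub>kA\<close> periodic with period \<open>L\<close>.
  Values of \<open>f\<close> outside the upper half plane are irrelevant.
\<close>

definition modular_form ::
    "int \<Rightarrow> (int ^ 2 ^ 2) set \<Rightarrow> (complex \<Rightarrow> complex) \<Rightarrow> bool" where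
  "modular_form k \<Gamma> f \<longleftrightarrow>
     f holomorphic_on upper_half_plane \<and>
     (\<forall>A\<in>\<Gamma>. \<forall>\<tau>\<in>upper_half_plane. slash k A f \<tau> = f \<tau>) \<and>
     (\<forall>A\<in>SL2Z. \<exists>C>0. bounded (slash k A f ` {\<tau>. Im \<tau> > C}))"


lemma is_lattice_period_lattice:
  assumes "\<tau> \<in> upper_half_plane"
  shows "is_lattice (period_lattice \<tau>)"
proof -
  have im: "Im \<tau> \<noteq> 0" using assms by (simp add: upper_half_plane_def)
  have "\<tau> \<noteq> 1" using im by auto
  moreover have "independent {\<tau>, 1}"
  proof -
    have "\<tau> \<notin> span {1}"
      using im by (auto simp: span_singleton complex_eq_iff)
    then show ?thesis by (simp add: independent_insert)
  qed
  moreover have "period_lattice \<tau> = {of_int m * \<tau> + of_int n * 1 | m n. True}"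
    by (simp add: period_lattice_def)
  ultimately show ?thesis unfolding is_lattice_def by blast
qed

lemma principal_congruence_subgroup_subset_Gamma_vec:
  assumes "of_int L * s \<in> \<int>" and "of_int L * t \<in> \<int>"
  shows "principal_congruence_subgroup L \<subseteq> Gamma_vec (s, t)"
proof
  fix A assume A: "A \<in> principal_congruence_subgroup L"
  then have "L dvd A $ 1 $ 1 - 1" "L dvd A $ 1 $ 2" "L dvd A $ 2 $ 1" "L dvd A $ 2 $ 2 - 1"
    by (auto simp: principal_congruence_subgroup_def cong_iff_dvd_diff)
  then obtain a b c d where *: "A $ 1 $ 1 = L * a + 1" "A $ 1 $ 2 = L * b"
      "A $ 2 $ 1 = L * c" "A $ 2 $ 2 = L * d + 1"
    by (metis dvd_def add_diff_cancel diff_add_cancel)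
  have "s * of_int (A $ 1 $ 1) + t * of_int (A $ 2 $ 1) - s
          = (of_int L * s) * of_int a + (of_int L * t) * of_int c"
       "s * of_int (A $ 1 $ 2) + t * of_int (A $ 2 $ 2) - t
          = (of_int L * s) * of_int b + (of_int L * t) * of_int d"
    by (simp_all add: * algebra_simps)
  moreover have "(of_int L * s) * of_int a + (of_int L * t) * of_int c \<in> \<int>"
    "(of_int L * s) * of_int b + (of_int L * t) * of_int d \<in> \<int>"
    by (intro Ints_add Ints_mult[OF assms(1)] Ints_mult[OF assms(2)] Ints_of_int)+
  ultimately have "row_times (s, t) A - (s, t) \<in> \<int> \<times> \<int>"
    by (simp add: row_times_def)
  then show "A \<in> Gamma_vec (s, t)"
    using A by (simp add: Gamma_vec_def principal_congruence_subgroup_def)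
qed

end

theory Submission
  imports Defs
begin

text \<open>
  Write \<open>z = s \<tau> + t\<close> and let \<open>\<omega> = m \<tau> + n\<close> run through the lattice. Two properties of \<open>\<wp>\<close>
  give the transformation law. First, \<open>\<wp>\<close> is homogeneous of degree \<open>-2\<close> in the pair of lattice and
  argument, and \<open>\<tau>\<int> + \<int>\<close> is \<open>c \<tau> + d\<close> times the lattice of \<open>A \<tau>\<close> for every \<open>A\<close> in \<open>SL(2, \<int>)\<close>; hence
  \<open>f\<^sub>v |\<^sub>2 A = f\<^sub>w\<close> with \<open>w = v A\<close> (lemma \<open>slash_division_value\<close>). Second, \<open>\<wp>\<close> is doubly periodic, so
  \<open>f\<^sub>v\<close> depends only on \<open>v\<close> modulo \<open>\<int>\<^sup>2\<close> (lemma \<open>division_value_cong\<close>). Together they give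
  invariance under \<open>\<Gamma>\<^sub>v\<close>, and they turn holomorphy at all cusps into the boundedness near \<open>i\<infinity>\<close> of
  every \<open>f\<^sub>w\<close> with \<open>w\<close> outside \<open>\<int>\<^sup>2\<close>.
  
  Periodicity under \<open>z \<mapsto> z + 1\<close> is a telescoping argument: the difference of the two series converges
  absolutely, and on each row of constant \<open>m\<close> it is \<open>\<Sum>\<^sub>n u(n - 1) - u(n)\<close> with \<open>u\<close> vanishing at
  both ends. The period \<open>\<tau>\<close> is then the period \<open>1\<close> of the lattice of \<open>-1/\<tau>\<close>.
  
  Holomorphy on the half plane and boundedness at the cusps both come from one estimate
  (lemma \<open>weierstrass_term_uniform_bound\<close>). By periodicity one may assume \<open>\<bar>s\<bar>, \<bar>t\<bar> \<le> 1/2\<close>. Then for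
  \<open>\<bar>Re \<tau>\<bar> \<le> L\<close> and \<open>Im \<tau> \<ge> \<eta>\<close> all terms except the one at \<open>\<omega> = 0\<close> are bounded by a constant times the
  summable weight \<open>max(1, \<bar>m\<bar>)\<^bsup>-3/2\<^esup> max(1, \<bar>n\<bar>)\<^bsup>-3/2\<^esup>\<close>, uniformly in \<open>s\<close>, \<open>t\<close> and, what matters at
  the cusp, uniformly as \<open>Im \<tau>\<close> grows. Holomorphy follows by the Weierstrass M-test. For boundedness,
  translating \<open>\<tau>\<close> by an integer brings \<open>Re \<tau>\<close> into \<open>[-1/2, 1/2]\<close>, which changes \<open>t\<close> but not \<open>s\<close>; since
  the estimate is uniform in \<open>t\<close>, only the term \<open>1/z\<^sup>2\<close> needs a separate look.
\<close>

section \<open>Lattice points and a summable weight\<close>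

definition lattice_point :: "complex \<Rightarrow> int \<times> int \<Rightarrow> complex" where
  "lattice_point \<tau> p = of_int (fst p) * \<tau> + of_int (snd p)"

text \<open>
  The exponent \<open>3/2\<close> splits the cubic decay of the Weierstrass terms evenly between the two
  coordinates; since \<open>3/2 > 1\<close>, the product weight is summable over \<open>\<int> \<times> \<int>\<close>, one coordinate at a time.
\<close>

definition int_weight :: "int \<Rightarrow> real" where
  "int_weight n = max 1 \<bar>of_int n\<bar> powr (- (3 / 2))"

definition lattice_weight :: "int \<times> int \<Rightarrow> real" where
  "lattice_weight p = int_weight (fst p) * int_weight (snd p)"

lemma int_weight_nonneg: "int_weight n \<ge> 0"
  by (simp add: int_weight_def)

lemma lattice_weight_nonneg: "lattice_weight p \<ge> 0"
  by (simp add: lattice_weight_def int_weight_nonneg)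

lemma summable_int_weight: "int_weight summable_on UNIV"
proof -
  have "summable (\<lambda>n. real n powr (- (3 / 2)))"
    by (simp add: summable_real_powr_iff)
  moreover have "\<forall>\<^sub>F n in sequentially. real n powr (- (3 / 2)) = int_weight (int n)"
    using eventually_ge_at_top[of 1] by eventually_elim (simp add: int_weight_def max_def)
  ultimately have "summable (\<lambda>n. int_weight (int n))"
    by (subst (asm) summable_cong)
  then have nat: "(\<lambda>n. int_weight (int n)) summable_on UNIV"
    by (intro norm_summable_imp_summable_on) (simp add: int_weight_nonneg)
  have "int_weight summable_on range int"
    using nat by (subst summable_on_reindex) (auto simp: o_def)
  moreover have "int_weight summable_on range (\<lambda>n. - int n)"
    using nat by (subst summable_on_reindex) (auto simp: o_def inj_def int_weight_def)
  moreover have "range int \<union> range (\<lambda>n. - int n) = UNIV"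
  proof (rule UNIV_eq_I [symmetric])
    show "k \<in> range int \<union> range (\<lambda>n. - int n)" for k
      by (cases k rule: int_cases2) auto
  qed
  ultimately show ?thesis
    using summable_on_union[of int_weight "range int" "range (\<lambda>n. - int n)"] by simp
qed

lemma summable_lattice_weight: "lattice_weight summable_on UNIV"
proof -
  have "((\<lambda>n. lattice_weight (m, n)) has_sum (int_weight m * infsum int_weight UNIV)) UNIV" for m
    unfolding lattice_weight_def fst_conv snd_conv
    by (intro has_sum_cmult_right has_sum_infsum summable_int_weight)
  moreover have "(\<lambda>m. int_weight m * infsum int_weight UNIV) summable_on UNIV"
    by (intro summable_on_cmult_left summable_int_weight)
  ultimately have "lattice_weight summable_on UNIV \<times> UNIV"
    by (intro summable_on_SigmaI) (auto simp: lattice_weight_nonneg)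
  then show ?thesis by simp
qed

text \<open>
  This is how a cubic bound in the maximum of two coordinates yields the product weight.
\<close>

lemma cube_ge_powr_mult:
  fixes a b M :: real
  assumes "0 < a" "a \<le> M" "0 < b" "b \<le> M"
  shows "a powr (3 / 2) * b powr (3 / 2) \<le> M ^ 3"
proof -
  have "a powr (3 / 2) * b powr (3 / 2) \<le> M powr (3 / 2) * M powr (3 / 2)"
    using assms by (intro mult_mono powr_mono2 powr_ge_zero) auto
  also have "\<dots> = M powr (3 / 2 + 3 / 2)"
    by (rule powr_add [symmetric])
  also have "3 / 2 + 3 / 2 = real 3"
    by simp
  also have "M powr real 3 = M ^ 3"
    using assms by (intro powr_realpow) auto
  finally show ?thesis .
qed

lemma lattice_weight_eq:
  "lattice_weight (m, n) =
     1 / (max 1 \<bar>of_int m\<bar> powr (3 / 2) * max 1 \<bar>of_int n\<bar> powr (3 / 2))"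
  by (simp add: lattice_weight_def int_weight_def powr_minus_divide)

text \<open>
  The gain over the trivial bound \<open>2 / \<rho>\<^sup>2\<close> comes from
  \<open>1/u\<^sup>2 - 1/v\<^sup>2 = (v - u) (1/(u v\<^sup>2) + 1/(u\<^sup>2 v))\<close>. Applied to \<open>z - \<omega>\<close> and \<open>- \<omega>\<close>, whose difference is
  \<open>z\<close>, it is what makes the Weierstrass series converge absolutely.
\<close>

lemma norm_diff_inverse_squares_le:
  fixes u v :: complex
  assumes "0 < \<rho>" "\<rho> \<le> norm u" "\<rho> \<le> norm v"
  shows "norm (1 / u ^ 2 - 1 / v ^ 2) \<le> 2 * norm (u - v) / \<rho> ^ 3"
proof -
  have nz: "u \<noteq> 0" "v \<noteq> 0" using assms by auto
  have "1 / u ^ 2 - 1 / v ^ 2 = (v - u) * (1 / (u * v ^ 2) + 1 / (u ^ 2 * v)) "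
    using nz by (simp add: field_simps power2_eq_square)
  also have "norm \<dots> \<le> norm (v - u) * (1 / \<rho> ^ 3 + 1 / \<rho> ^ 3)"
  proof (unfold norm_mult, rule mult_left_mono)
    have *: "norm (1 / (x * y ^ 2)) \<le> 1 / \<rho> ^ 3" if "\<rho> \<le> norm x" "\<rho> \<le> norm y" for x y :: complex
    proof -
      have "\<rho> * \<rho> ^ 2 \<le> norm x * norm y ^ 2"
        using that assms(1) by (intro mult_mono power_mono) auto
      then show ?thesis
        using assms(1) by (simp add: norm_divide norm_mult norm_power power3_eq_cube
            power2_eq_square mult.assoc frac_le)
    qed
    show "norm (1 / (u * v ^ 2) + 1 / (u ^ 2 * v)) \<le> 1 / \<rho> ^ 3 + 1 / \<rho> ^ 3"
      using *[of u v] *[of v u] assms(2,3)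
      by (intro norm_triangle_le add_mono) (simp_all add: mult.commute)
  qed auto
  also have "\<dots> = 2 * norm (u - v) / \<rho> ^ 3"
    by (simp add: norm_minus_commute)
  finally show ?thesis .
qed

text \<open>
  The imaginary part of \<open>a \<tau> + b\<close> controls \<open>a\<close>; the real part then controls \<open>b\<close> up to \<open>\<bar>a\<bar> L\<close>. The factor
  \<open>Im \<tau>\<close> in the first bound is kept, because it provides the decay needed near \<open>i\<infinity>\<close>.
\<close>

lemma norm_lattice_combination_ge:
  fixes a b L \<eta> :: real
  assumes "\<bar>Re \<tau>\<bar> \<le> L" "0 < \<eta>" "\<eta> \<le> Im \<tau>"
  shows "\<bar>a\<bar> * Im \<tau> \<le> norm (of_real a * \<tau> + of_real b)"
    and "\<bar>b\<bar> \<le> (1 + L / \<eta>) * norm (of_real a * \<tau> + of_real b)"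
proof -
  let ?w = "of_real a * \<tau> + of_real b :: complex"
  show 1: "\<bar>a\<bar> * Im \<tau> \<le> norm ?w"
    using abs_Im_le_cmod[of ?w] assms by (simp add: abs_mult)
  have "\<bar>a\<bar> * \<eta> \<le> norm ?w"
    using 1 mult_left_mono[OF assms(3), of "\<bar>a\<bar>"] by simp
  then have a: "\<bar>a\<bar> \<le> norm ?w / \<eta>"
    using assms by (simp add: field_simps)
  have "\<bar>b\<bar> \<le> \<bar>Re ?w\<bar> + \<bar>a\<bar> * \<bar>Re \<tau>\<bar>"
    by (simp flip: abs_mult)
  also have "\<dots> \<le> norm ?w + (norm ?w / \<eta>) * L"
    using a assms by (intro add_mono abs_Re_le_cmod mult_mono) auto
  finally show "\<bar>b\<bar> \<le> (1 + L / \<eta>) * norm ?w"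
    by (simp add: algebra_simps)
qed

lemma lattice_point_of_real:
  "lattice_point \<tau> (m, n) = of_real (of_int m) * \<tau> + of_real (of_int n)"
  by (simp add: lattice_point_def)

lemma lattice_point_eq_0_iff:
  assumes "\<tau> \<in> upper_half_plane"
  shows "lattice_point \<tau> p = 0 \<longleftrightarrow> p = (0, 0)"
  using assms by (cases p) (auto simp: lattice_point_def upper_half_plane_def complex_eq_iff)

lemma inj_lattice_point:
  assumes "\<tau> \<in> upper_half_plane"
  shows "inj (lattice_point \<tau>)"
proof (rule injI)
  fix p q assume "lattice_point \<tau> p = lattice_point \<tau> q"
  then have "lattice_point \<tau> (p - q) = 0"
    by (simp add: lattice_point_def algebra_simps)
  then have "p - q = (0, 0)"
    using lattice_point_eq_0_iff[OF assms] by blast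
  then show "p = q" by (simp add: prod_eq_iff)
qed

lemma period_lattice_eq_range: "period_lattice \<tau> = range (lattice_point \<tau>)"
  by (auto simp: period_lattice_def lattice_point_def image_def)

section \<open>Absolute convergence\<close>

text \<open>
  The first bound majorizes the tail of the series; the second one shows that only finitely many
  lattice points lie in a given disc.
\<close>

lemma lattice_point_lower_bounds:
  assumes "\<tau> \<in> upper_half_plane"
  obtains c where "c > 0" "\<And>p. p \<noteq> (0, 0) \<Longrightarrow> 1 / norm (lattice_point \<tau> p) ^ 3 \<le> c * lattice_weight p"
    "\<And>m n. max \<bar>of_int m\<bar> \<bar>of_int n\<bar> \<le> c * norm (lattice_point \<tau> (m, n))"
proof -
  define y where "y = Im \<tau>"
  have y: "y > 0" using assms by (simp add: y_def upper_half_plane_def)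
  define B where "B = 1 + \<bar>Re \<tau>\<bar> / y + 1 / y"
  have B: "B \<ge> 1" using y by (simp add: B_def)
  have le: "\<bar>of_int m\<bar> \<le> B * norm (lattice_point \<tau> (m, n))"
     "\<bar>of_int n\<bar> \<le> B * norm (lattice_point \<tau> (m, n))" for m n
  proof -
    let ?r = "norm (lattice_point \<tau> (m, n))"
    have "\<bar>of_int m\<bar> * y \<le> ?r"
      using norm_lattice_combination_ge(1)[of \<tau> "\<bar>Re \<tau>\<bar>" y "of_int m" "of_int n"] y
      by (simp add: lattice_point_of_real y_def)
    then have "\<bar>of_int m\<bar> \<le> (1 / y) * ?r"
      using y by (simp add: field_simps)
    also have "\<dots> \<le> B * ?r"
      using y by (intro mult_right_mono) (auto simp: B_def)
    finally show "\<bar>of_int m\<bar> \<le> B * ?r" .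
    have "\<bar>of_int n\<bar> \<le> (1 + \<bar>Re \<tau>\<bar> / y) * ?r"
      using norm_lattice_combination_ge(2)[of \<tau> "\<bar>Re \<tau>\<bar>" y "of_int n" "of_int m"] y
      by (simp add: lattice_point_of_real y_def)
    also have "\<dots> \<le> B * ?r"
      using y by (intro mult_right_mono) (auto simp: B_def)
    finally show "\<bar>of_int n\<bar> \<le> B * ?r" .
  qed
  show ?thesis
  proof (rule that[of "B ^ 3"])
    show "B ^ 3 > 0" using B by simp
  next
    fix p :: "int \<times> int" assume p: "p \<noteq> (0, 0)"
    obtain m n where mn: "p = (m, n)" by (cases p)
    let ?r = "norm (lattice_point \<tau> p)"
    have r: "?r > 0" using lattice_point_eq_0_iff[OF assms] p by simp
    have "1 \<le> max \<bar>real_of_int m\<bar> \<bar>of_int n\<bar>"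
      using p mn by auto
    also have "\<dots> \<le> B * ?r" using le(1)[of m n] le(2)[of n m] by (simp add: mn)
    finally have "1 \<le> B * ?r" .
    then have "max 1 \<bar>of_int m\<bar> powr (3 / 2) * max 1 \<bar>of_int n\<bar> powr (3 / 2) \<le> (B * ?r) ^ 3"
      using le(1)[of m n] le(2)[of n m] mn by (intro cube_ge_powr_mult) auto
    then show "1 / ?r ^ 3 \<le> B ^ 3 * lattice_weight p"
      using r by (simp add: mn lattice_weight_eq field_simps power_mult_distrib)
  next
    fix m n
    have "B \<le> B ^ 3" using B by (simp add: self_le_power)
    then have "B * norm (lattice_point \<tau> (m, n)) \<le> B ^ 3 * norm (lattice_point \<tau> (m, n))"
      by (intro mult_right_mono) auto
    then show "max \<bar>of_int m\<bar> \<bar>of_int n\<bar> \<le> B ^ 3 * norm (lattice_point \<tau> (m, n))"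
      using le(1)[of m n] le(2)[of n m] by simp
  qed
qed

text \<open>
  Here \<open>z\<close> is arbitrary and the term at \<open>\<omega> = 0\<close> is included: since \<open>1 / 0 = 0\<close>, that term is just
  \<open>1 / z\<^sup>2\<close>, and a lattice point equal to \<open>z\<close> does no harm. This makes the whole lattice, on which
  translations act, available as index set. All but finitely many \<open>\<omega>\<close> satisfy \<open>\<bar>\<omega>\<bar> \<ge> 2 \<bar>z\<bar>\<close>, and for them
  both \<open>z - \<omega>\<close> and \<open>\<omega>\<close> have norm at least \<open>\<bar>\<omega>\<bar> / 2\<close>.
\<close>

lemma summable_weierstrass_terms:
  assumes "\<tau> \<in> upper_half_plane"
  shows "(\<lambda>p. 1 / (z - lattice_point \<tau> p) ^ 2 - 1 / lattice_point \<tau> p ^ 2) summable_on UNIV"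
proof -
  let ?g = "\<lambda>p. 1 / (z - lattice_point \<tau> p) ^ 2 - 1 / lattice_point \<tau> p ^ 2"
  from assms obtain c where c: "c > 0"
    "\<And>p. p \<noteq> (0, 0) \<Longrightarrow> 1 / norm (lattice_point \<tau> p) ^ 3 \<le> c * lattice_weight p"
    "\<And>m n. max \<bar>of_int m\<bar> \<bar>of_int n\<bar> \<le> c * norm (lattice_point \<tau> (m, n))"
    by (rule lattice_point_lower_bounds) blast
  define S where "S = {p. p \<noteq> (0, 0) \<and> 2 * norm z \<le> norm (lattice_point \<tau> p)}"
  \<comment> \<open>The finitely many points outside \<open>S\<close> include all those where a denominator vanishes.\<close>
  have "finite (- S)"
  proof (rule finite_subset)
    define N where "N = \<lceil>c * (2 * norm z)\<rceil>"
    have "0 \<le> c * (2 * norm z)" using c(1) by simp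
    also have N: "\<dots> \<le> real_of_int N" unfolding N_def by (rule le_of_int_ceiling)
    finally have "N \<ge> 0" by simp
    show "- S \<subseteq> {-N..N} \<times> {-N..N}"
    proof
      fix p assume "p \<in> - S"
      obtain m n where p: "p = (m, n)" by (cases p)
      show "p \<in> {-N..N} \<times> {-N..N}"
      proof (cases "p = (0, 0)")
        case False
        then have "norm (lattice_point \<tau> p) \<le> 2 * norm z"
          using \<open>p \<in> - S\<close> by (auto simp: S_def)
        then have "c * norm (lattice_point \<tau> p) \<le> c * (2 * norm z)"
          using c(1) by (intro mult_left_mono) auto
        then have "max \<bar>of_int m\<bar> \<bar>of_int n\<bar> \<le> real_of_int N"
          using c(3)[of m n] N unfolding p by (meson order_trans)
        then show ?thesis using p by (auto simp: abs_le_iff) 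
      qed (use \<open>N \<ge> 0\<close> in auto)
    qed
  qed auto
  have "(\<lambda>p. 16 * norm z * c * lattice_weight p) summable_on S"
    by (intro summable_on_cmult_right summable_on_subset_banach[OF summable_lattice_weight]) auto
  moreover have "norm (?g p) \<le> 16 * norm z * c * lattice_weight p" if "p \<in> S" for p
  proof -
    let ?w = "lattice_point \<tau> p"
    have w: "?w \<noteq> 0" "2 * norm z \<le> norm ?w"
      using that lattice_point_eq_0_iff[OF assms] by (auto simp: S_def)
    have "norm ?w \<le> norm (z - ?w) + norm z"
      using norm_triangle_sub[of ?w z] by (simp add: norm_minus_commute)
    then have "norm (?g p) \<le> 2 * norm (z - ?w - (- ?w)) / (norm ?w / 2) ^ 3"
      using norm_diff_inverse_squares_le[of "norm ?w / 2" "z - ?w" "- ?w"] w by simp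
    also have "\<dots> = 16 * norm z * (1 / norm ?w ^ 3)"
      by (simp add: power_divide)
    also have "\<dots> \<le> 16 * norm z * (c * lattice_weight p)"
      using c(2)[of p] that by (intro mult_left_mono) (auto simp: S_def)
    finally show ?thesis by simp
  qed
  ultimately have "?g summable_on S"
    by (rule abs_summable_summable [OF Infinite_Sum.abs_summable_on_comparison_test'])
  moreover have "?g summable_on - S"
    using \<open>finite (- S)\<close> by simp
  ultimately have "?g summable_on (S \<union> - S)"
    by (rule summable_on_union)
  then show ?thesis by simp
qed

section \<open>Homogeneity and change of basis\<close>

lemma weierstrass_p_scale:
  assumes "l \<noteq> 0"
  shows "weierstrass_p ((*) l ` \<Omega>) (l * z) = weierstrass_p \<Omega> z / l ^ 2"
proof -
  have "(*) l ` \<Omega> - {0} = (*) l ` (\<Omega> - {0})"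
    using assms by auto
  then have "(\<Sum>\<^sub>\<infinity>\<omega>\<in>(*) l ` \<Omega> - {0}. 1 / (l * z - \<omega>) ^ 2 - 1 / \<omega> ^ 2) =
      (\<Sum>\<^sub>\<infinity>\<omega>\<in>\<Omega> - {0}. 1 / (l * z - l * \<omega>) ^ 2 - 1 / (l * \<omega>) ^ 2)"
    using assms by (simp add: infsum_reindex inj_on_def o_def)
  also have "\<dots> = (\<Sum>\<^sub>\<infinity>\<omega>\<in>\<Omega> - {0}. (1 / l ^ 2) * (1 / (z - \<omega>) ^ 2 - 1 / \<omega> ^ 2))"
  proof (rule infsum_cong)
    fix \<omega>
    have "(l * z - l * \<omega>) ^ 2 = l ^ 2 * (z - \<omega>) ^ 2"
      by (simp only: right_diff_distrib[symmetric] power_mult_distrib)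
    then show "1 / (l * z - l * \<omega>) ^ 2 - 1 / (l * \<omega>) ^ 2 =
        (1 / l ^ 2) * (1 / (z - \<omega>) ^ 2 - 1 / \<omega> ^ 2)"
      by (simp only: power_mult_distrib right_diff_distrib) simp
  qed
  also have "\<dots> = (1 / l ^ 2) * (\<Sum>\<^sub>\<infinity>\<omega>\<in>\<Omega> - {0}. 1 / (z - \<omega>) ^ 2 - 1 / \<omega> ^ 2)"
    by (rule infsum_cmult_right')
  finally show ?thesis
    by (simp add: weierstrass_p_def power_mult_distrib add_divide_distrib)
qed

text \<open>
  The numbers \<open>a \<tau> + b\<close> and \<open>c \<tau> + d\<close> form another basis of \<open>\<tau>\<int> + \<int>\<close>, and their quotient is \<open>A \<tau>\<close>. The
  inverse matrix expresses the old coordinates by the new ones.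
\<close>

lemma period_lattice_moebius:
  fixes a b c d :: int
  assumes "a * d - b * c = 1" "of_int c * \<tau> + of_int d \<noteq> 0"
  shows "period_lattice \<tau> = (*) (of_int c * \<tau> + of_int d) `
           period_lattice ((of_int a * \<tau> + of_int b) / (of_int c * \<tau> + of_int d))"
    (is "_ = (*) ?j ` period_lattice ?\<tau>'")
proof -
  have eq: "?j * (of_int m * ?\<tau>' + of_int n) =
      of_int (m * a + n * c) * \<tau> + of_int (m * b + n * d)" for m n
    using assms(2) by (simp add: field_simps)
  show ?thesis
  proof (intro equalityI subsetI)
    fix w assume "w \<in> period_lattice \<tau>"
    then obtain p q where w: "w = of_int p * \<tau> + of_int q"
      by (auto simp: period_lattice_def)
    define m n where "m = p * d - q * c" and "n = q * a - p * b"
    have "m * a + n * c = p * (a * d - b * c)" "m * b + n * d = q * (a * d - b * c)"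
      by (simp_all add: m_def n_def algebra_simps)
    then have "w = ?j * (of_int m * ?\<tau>' + of_int n)"
      by (simp only: eq w assms(1) mult_1_right)
    then show "w \<in> (*) ?j ` period_lattice ?\<tau>'"
      by (auto simp: period_lattice_def)
  next
    fix w assume "w \<in> (*) ?j ` period_lattice ?\<tau>'"
    then obtain m n where "w = ?j * (of_int m * ?\<tau>' + of_int n)"
      by (auto simp: period_lattice_def)
    then show "w \<in> period_lattice \<tau>"
      unfolding eq period_lattice_def by blast
  qed
qed

lemma automorphy_factor_nonzero:
  fixes a b c d :: int
  assumes "a * d - b * c = 1" "\<tau> \<in> upper_half_plane"
  shows "of_int c * \<tau> + of_int d \<noteq> 0"
proof -
  have "(c, d) \<noteq> (0, 0)" using assms(1) by auto
  then show ?thesis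
    using lattice_point_eq_0_iff[OF assms(2), of "(c, d)"] by (simp add: lattice_point_def)
qed

lemma wp_tau_moebius:
  fixes a b c d :: int
  assumes "a * d - b * c = 1" "\<tau> \<in> upper_half_plane"
  defines "j \<equiv> of_int c * \<tau> + of_int d"
  shows "wp_tau ((of_int a * \<tau> + of_int b) / j) (z / j) = j ^ 2 * wp_tau \<tau> z"
proof -
  have j: "j \<noteq> 0" unfolding j_def by (rule automorphy_factor_nonzero[OF assms(1,2)])
  let ?\<tau>' = "(of_int a * \<tau> + of_int b) / j"
  have "period_lattice \<tau> = (*) j ` period_lattice ?\<tau>'"
    using j unfolding j_def by (rule period_lattice_moebius[OF assms(1)])
  then have "wp_tau \<tau> z = wp_tau ?\<tau>' (z / j) / j ^ 2"
    using weierstrass_p_scale[OF j, of "period_lattice ?\<tau>'" "z / j"] j by (simp add: wp_tau_def)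
  then show ?thesis using j by simp
qed

lemma moebius_upper_half_plane:
  fixes a b c d :: int
  assumes "a * d - b * c = 1" "\<tau> \<in> upper_half_plane"
  shows "(of_int a * \<tau> + of_int b) / (of_int c * \<tau> + of_int d) \<in> upper_half_plane"
proof -
  let ?j = "of_int c * \<tau> + of_int d"
  have j: "?j \<noteq> 0" using automorphy_factor_nonzero assms by blast
  have "real_of_int a * of_int d - of_int b * of_int c = 1"
    using assms(1) by (metis of_int_1 of_int_diff of_int_mult)
  then have "Im ((of_int a * \<tau> + of_int b) * cnj ?j) = Im \<tau>"
    by simp algebra
  then have "Im ((of_int a * \<tau> + of_int b) / ?j) = Im \<tau> / norm ?j ^ 2"
    by (simp only: complex_div_cnj[of _ ?j] Im_divide_of_real flip: of_real_power)
  then show ?thesis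
    using assms(2) j by (simp add: upper_half_plane_def)
qed

section \<open>Double periodicity\<close>

lemma wp_tau_eq_infsum:
  assumes "\<tau> \<in> upper_half_plane"
  shows "wp_tau \<tau> z =
    1 / z ^ 2 + (\<Sum>\<^sub>\<infinity>p\<in>- {(0, 0)}. 1 / (z - lattice_point \<tau> p) ^ 2 - 1 / lattice_point \<tau> p ^ 2)"
proof -
  have "period_lattice \<tau> - {0} = lattice_point \<tau> ` (- {(0, 0)})"
    using lattice_point_eq_0_iff[OF assms] by (auto simp: period_lattice_eq_range)
  then show ?thesis
    using inj_on_subset[OF inj_lattice_point[OF assms]]
    by (simp add: wp_tau_def weierstrass_p_def infsum_reindex o_def)
qed

lemma has_sum_wp_tau:
  assumes "\<tau> \<in> upper_half_plane"
  shows "((\<lambda>p. 1 / (z - lattice_point \<tau> p) ^ 2 - 1 / lattice_point \<tau> p ^ 2) has_sum wp_tau \<tau> z) UNIV"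
proof -
  let ?g = "\<lambda>p. 1 / (z - lattice_point \<tau> p) ^ 2 - 1 / lattice_point \<tau> p ^ 2"
  have "infsum ?g (insert (0, 0) (- {(0, 0)})) = ?g (0, 0) + infsum ?g (- {(0, 0)})"
    by (intro infsum_insert summable_on_subset_banach[OF summable_weierstrass_terms[OF assms]]) auto
  moreover have "insert (0, 0) (- {(0, 0)}) = (UNIV :: (int \<times> int) set)"
    by auto
  ultimately have "infsum ?g UNIV = wp_tau \<tau> z"
    by (simp add: wp_tau_eq_infsum[OF assms] lattice_point_def)
  then show ?thesis
    using has_sum_infsum[OF summable_weierstrass_terms[OF assms, of z]] by simp
qed

lemma sum_int_telescope:
  fixes u :: "int \<Rightarrow> 'a :: ab_group_add"
  shows "(\<Sum>n\<in>{- int N..int N}. u (n - 1) - u n) = u (- int N - 1) - u (int N)"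
proof (induction N)
  case (Suc N)
  let ?A = "{- int N..int N}"
  have A: "{- int (Suc N)..int (Suc N)} = insert (- int N - 1) (insert (int N + 1) ?A)"
    by auto
  have "(\<Sum>n\<in>{- int (Suc N)..int (Suc N)}. u (n - 1) - u n) =
      (u (- int N - 1 - 1) - u (- int N - 1)) +
      ((u (int N + 1 - 1) - u (int N + 1)) + (\<Sum>n\<in>?A. u (n - 1) - u n))"
    unfolding A by (subst sum.insert, simp, force)+ (rule refl)
  also have "int N + 1 - 1 = int N"
    by simp
  also have "(u (- int N - 1 - 1) - u (- int N - 1)) +
      ((u (int N) - u (int N + 1)) + (\<Sum>n\<in>?A. u (n - 1) - u n)) =
      u (- int N - 1 - 1) - u (int N + 1)"
    unfolding Suc.IH by (simp only: algebra_simps)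
  also have "- int N - 1 = - int (Suc N)" by simp
  also have "int N + 1 = int (Suc N)" by simp
  finally show ?case .
qed simp

text \<open>
  Summability is assumed, so the sum may be computed along the symmetric intervals
  \<open>{-N..N}\<close>, whose partial sums collapse to two boundary terms.
\<close>

lemma infsum_int_telescope:
  fixes u :: "int \<Rightarrow> 'a :: {real_normed_vector}"
  assumes "(\<lambda>n. u (n - 1) - u n) summable_on UNIV"
    and "(\<lambda>N. u (int N)) \<longlonglongrightarrow> 0" "(\<lambda>N. u (- int N)) \<longlonglongrightarrow> 0"
  shows "(\<Sum>\<^sub>\<infinity>n. u (n - 1) - u n) = 0"
proof -
  let ?A = "\<lambda>N. {- int N..int N}"
  have "filterlim ?A (finite_subsets_at_top UNIV) sequentially"
    unfolding filterlim_finite_subsets_at_top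
  proof safe
    fix X :: "int set" assume "finite X"
    then obtain b where "abs ` X \<subseteq> {..b}"
      using finite_int_iff_bounded_le by blast
    then have b: "\<And>n. n \<in> X \<Longrightarrow> \<bar>n\<bar> \<le> b"
      by auto
    show "\<forall>\<^sub>F N in sequentially. finite (?A N) \<and> X \<subseteq> ?A N \<and> ?A N \<subseteq> UNIV"
      using eventually_ge_at_top[of "nat b"]
      by eventually_elim (use b in \<open>force simp: abs_le_iff\<close>)
  qed
  with infsum_tendsto[OF assms(1)]
  have "(\<lambda>N. \<Sum>n\<in>?A N. u (n - 1) - u n) \<longlonglongrightarrow> (\<Sum>\<^sub>\<infinity>n. u (n - 1) - u n)"
    by (rule filterlim_compose)
  moreover have "(\<lambda>N. u (- int N - 1) - u (int N)) \<longlonglongrightarrow> 0 - 0"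
  proof (intro tendsto_diff assms(2))
    have "- int (Suc N) = - int N - 1" for N by simp
    then show "(\<lambda>N. u (- int N - 1)) \<longlonglongrightarrow> 0"
      using LIMSEQ_Suc[OF assms(3)] by (simp only:)
  qed
  ultimately show ?thesis
    unfolding sum_int_telescope by (auto dest: LIMSEQ_unique)
qed

lemma tendsto_inverse_square_shift:
  fixes w :: complex
  assumes "\<bar>e\<bar> = 1"
  shows "(\<lambda>N. 1 / (w - of_int (e * int N)) ^ 2) \<longlonglongrightarrow> 0"
proof -
  have e: "e = 1 \<or> e = -1" using assms by linarith
  have "filterlim (\<lambda>N. of_nat N - of_int e * w) at_infinity sequentially"
    using tendsto_add_filterlim_at_infinity'[OF tendsto_of_nat tendsto_const, of "- of_int e * w"]
    by simp
  then have "(\<lambda>N. inverse (of_nat N - of_int e * w)) \<longlonglongrightarrow> 0"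
    by (rule filterlim_compose[OF tendsto_inverse_0])
  then have "(\<lambda>N. inverse (of_nat N - of_int e * w) ^ 2) \<longlonglongrightarrow> 0 ^ 2"
    by (rule tendsto_power)
  moreover have "inverse (of_nat N - of_int e * w) ^ 2 = 1 / (w - of_int (e * int N)) ^ 2" for N
    using e by (auto simp: inverse_eq_divide power_one_over power2_commute[of _ w] 
        power2_eq_square algebra_simps)
  ultimately show ?thesis by simp
qed

text \<open>
  Shifting \<open>z\<close> by \<open>1\<close> shifts the index \<open>n\<close> by one and leaves the subtracted terms \<open>1/\<omega>\<^sup>2\<close> unchanged. These
  cancel in the difference of the two series, which can therefore be summed row by row and telescopes.
\<close>

lemma wp_tau_plus_1:
  assumes "\<tau> \<in> upper_half_plane"
  shows "wp_tau \<tau> (z + 1) = wp_tau \<tau> z"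
proof -
  let ?w = "lattice_point \<tau>"
  define u where "u p = 1 / (z - ?w p) ^ 2" for p
  define h where "h p = u (fst p, snd p - 1) - u p" for p
  have u: "u (m, n - 1) = 1 / (z + 1 - ?w (m, n)) ^ 2" for m n
    by (simp add: u_def lattice_point_def algebra_simps)
  have h: "h p = (1 / (z + 1 - ?w p) ^ 2 - 1 / ?w p ^ 2) - (1 / (z - ?w p) ^ 2 - 1 / ?w p ^ 2)" for p
    using u by (cases p) (simp add: h_def, simp add: u_def)
  have sum: "(h has_sum (wp_tau \<tau> (z + 1) - wp_tau \<tau> z)) UNIV"
  proof -
    have "((\<lambda>p. (1 / (z + 1 - ?w p) ^ 2 - 1 / ?w p ^ 2) + - (1 / (z - ?w p) ^ 2 - 1 / ?w p ^ 2))
        has_sum (wp_tau \<tau> (z + 1) + - wp_tau \<tau> z)) UNIV"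
      by (intro has_sum_add has_sum_uminusI has_sum_wp_tau assms)
    then show ?thesis
      unfolding h by (simp only: diff_conv_add_uminus)
  qed
  then have summable: "h summable_on UNIV"
    by (rule has_sum_imp_summable)
  have row: "(\<Sum>\<^sub>\<infinity>n. h (m, n)) = 0" for m
  proof -
    have "inj (Pair m)" by (simp add: inj_def)
    then have "(\<lambda>n. h (m, n)) summable_on UNIV"
      using summable_on_reindex[of "Pair m" UNIV h] summable_on_subset_banach[OF summable, of "range (Pair m)"]
      by (simp add: o_def)
    moreover have "(\<lambda>N. u (m, e * int N)) \<longlonglongrightarrow> 0" if "\<bar>e\<bar> = 1" for e
      using tendsto_inverse_square_shift[OF that, of "z - of_int m * \<tau>"]
      by (simp add: u_def lattice_point_def diff_diff_eq)
    from this[of 1] this[of "-1"] have "(\<lambda>N. u (m, int N)) \<longlonglongrightarrow> 0" "(\<lambda>N. u (m, - int N)) \<longlonglongrightarrow> 0"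
      by simp_all
    ultimately show ?thesis
      using infsum_int_telescope[of "\<lambda>n. u (m, n)"] by (simp add: h_def)
  qed
  have "wp_tau \<tau> (z + 1) - wp_tau \<tau> z = infsum h UNIV"
    using sum by (rule infsumI [symmetric])
  also have "\<dots> = (\<Sum>\<^sub>\<infinity>m. \<Sum>\<^sub>\<infinity>n. h (m, n))"
    using infsum_Sigma_banach[of h UNIV "\<lambda>_. UNIV"] summable by simp
  also have "\<dots> = 0"
    by (simp add: row)
  finally show ?thesis by simp
qed

text \<open>
  The inversion \<open>\<tau> \<mapsto> -1/\<tau>\<close> exchanges the two basis periods, so this is the previous lemma for the
  lattice of \<open>-1/\<tau>\<close>.
\<close>

lemma wp_tau_plus_tau:
  assumes "\<tau> \<in> upper_half_plane"
  shows "wp_tau \<tau> (z + \<tau>) = wp_tau \<tau> z"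
proof -
  have nz: "\<tau> \<noteq> 0" using assms by (auto simp: upper_half_plane_def)
  have S: "wp_tau (- 1 / \<tau>) (w / \<tau>) = \<tau> ^ 2 * wp_tau \<tau> w" for w
    using wp_tau_moebius[of 0 0 "-1" 1 \<tau> w] assms by simp
  have "- 1 / \<tau> \<in> upper_half_plane"
    using moebius_upper_half_plane[of 0 0 "-1" 1 \<tau>] assms by simp
  then have "wp_tau (- 1 / \<tau>) (z / \<tau> + 1) = wp_tau (- 1 / \<tau>) (z / \<tau>)"
    by (rule wp_tau_plus_1)
  then show ?thesis
    using S[of z] S[of "z + \<tau>"] nz by (simp add: add_divide_distrib)
qed

lemma wp_tau_periodic:
  assumes "\<tau> \<in> upper_half_plane"
  shows "wp_tau \<tau> (z + of_int m * \<tau> + of_int n) = wp_tau \<tau> z"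
proof -
  interpret one: periodic_fun_simple "wp_tau \<tau>" 1
    by standard (rule wp_tau_plus_1[OF assms])
  interpret tau: periodic_fun_simple "wp_tau \<tau>" \<tau>
    by standard (rule wp_tau_plus_tau[OF assms])
  show ?thesis
    using one.plus_of_int[of "z + of_int m * \<tau>" n] tau.plus_of_int[of z m] by simp
qed

section \<open>A uniform bound for the terms\<close>

lemma abs_int_minus_small_ge:
  fixes s :: real
  assumes "\<bar>s\<bar> \<le> 1 / 2"
  shows "\<bar>of_int m\<bar> / 2 \<le> \<bar>of_int m - s\<bar>"
proof (cases "m = 0")
  case False
  then have "1 \<le> \<bar>real_of_int m\<bar>" by linarith
  then show ?thesis using assms by linarith
qed simp

text \<open>
  For reduced \<open>s\<close> and \<open>t\<close> both \<open>\<omega>\<close> and \<open>z - \<omega>\<close> have coordinates at least half as large as those of \<open>\<omega>\<close>,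
  so that both norms are at least \<open>M / (2 D)\<close> with \<open>M\<close> comparable to \<open>max(\<bar>m\<bar> Im \<tau>, \<bar>n\<bar>)\<close>. If \<open>m \<noteq> 0\<close>,
  the terms are at most of order \<open>\<bar>z\<bar> / M\<^sup>3\<close>. Here \<open>\<bar>z\<bar>\<close> may grow like \<open>Im \<tau>\<close>, but the lower bound for
  \<open>M\<^sup>3\<close> contains the factor \<open>(Im \<tau>)\<^bsup>3/2\<^esup>\<close>, besides the inverse of the weight. If
  \<open>m = 0\<close>, there is no such factor, and the two squares are bounded separately by a multiple of \<open>1/n\<^sup>2\<close>.
\<close>

lemma weierstrass_term_uniform_bound:
  fixes L \<eta> :: real
  assumes "0 < \<eta>" "\<eta> \<le> 1" "0 \<le> L"
  obtains K where
    "\<And>\<tau> s t p. \<bar>Re \<tau>\<bar> \<le> L \<Longrightarrow> \<eta> \<le> Im \<tau> \<Longrightarrow> \<bar>s\<bar> \<le> 1 / 2 \<Longrightarrow> \<bar>t\<bar> \<le> 1 / 2 \<Longrightarrow> p \<noteq> (0, 0) \<Longrightarrow>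
       norm (1 / (of_real s * \<tau> + of_real t - lattice_point \<tau> p) ^ 2 - 1 / lattice_point \<tau> p ^ 2)
         \<le> K * lattice_weight p"
proof -
  define D where "D = 1 + L / \<eta>"
  define Z where "Z = 1 + L / \<eta> + 1 / \<eta>"
  have D: "D \<ge> 1" and Z: "Z \<ge> 1" using assms by (simp_all add: D_def Z_def)
  define K1 where "K1 = 16 * Z * D ^ 3 / \<eta> ^ 2"
  have K1: "K1 \<ge> 0" using D Z by (simp add: K1_def)
  show ?thesis
  proof (rule that[of "K1 + 8 * D ^ 2"])
    fix \<tau> :: complex and s t :: real and p :: "int \<times> int"
    assume \<tau>: "\<bar>Re \<tau>\<bar> \<le> L" "\<eta> \<le> Im \<tau>" and st: "\<bar>s\<bar> \<le> 1 / 2" "\<bar>t\<bar> \<le> 1 / 2" and p: "p \<noteq> (0, 0)"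
    define y where "y = Im \<tau>"
    have y: "y > 0" "\<eta> \<le> y" using assms(1) \<tau>(2) by (simp_all add: y_def)
    obtain m n where mn: "p = (m, n)" by (cases p)
    define z where "z = of_real s * \<tau> + of_real t"
    define w where "w = lattice_point \<tau> p"
    have far: "\<bar>of_int m\<bar> * y / (2 * D) \<le> norm (of_real a * \<tau> + of_real b)
          \<and> \<bar>of_int n\<bar> / (2 * D) \<le> norm (of_real a * \<tau> + of_real b)"
      if ab: "\<bar>of_int m\<bar> / 2 \<le> \<bar>a\<bar>" "\<bar>of_int n\<bar> / 2 \<le> \<bar>b\<bar>" for a b :: real
    proof
      let ?r = "norm (of_real a * \<tau> + of_real b)"
      have "\<bar>of_int m\<bar> / 2 * y \<le> \<bar>a\<bar> * y"
        using ab(1) y by (intro mult_right_mono) auto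
      also have "\<dots> \<le> ?r"
        using norm_lattice_combination_ge(1)[OF \<tau>(1) assms(1) \<tau>(2)] by (simp add: y_def)
      also have "\<dots> \<le> D * ?r"
        using D by (simp add: mult_le_cancel_right1)
      finally show "\<bar>of_int m\<bar> * y / (2 * D) \<le> ?r"
        using D by (simp add: field_simps)
      have "\<bar>of_int n\<bar> / 2 \<le> D * ?r"
        using ab(2) norm_lattice_combination_ge(2)[OF \<tau>(1) assms(1) \<tau>(2), of b a]
        unfolding D_def by (rule order_trans)
      then show "\<bar>of_int n\<bar> / (2 * D) \<le> ?r"
        using D by (simp add: field_simps)
    qed
    have "- w = of_real (- of_int m) * \<tau> + of_real (- of_int n)"
      by (simp add: w_def mn lattice_point_def)
    then have far_w: "\<bar>of_int m\<bar> * y / (2 * D) \<le> norm (- w)" "\<bar>of_int n\<bar> / (2 * D) \<le> norm (- w)"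
      using far[of "- of_int m" "- of_int n"] by simp_all
    have "z - w = of_real (s - of_int m) * \<tau> + of_real (t - of_int n)"
      by (simp add: z_def w_def mn lattice_point_def algebra_simps)
    moreover have "\<bar>of_int m\<bar> / 2 \<le> \<bar>s - of_int m\<bar>" "\<bar>of_int n\<bar> / 2 \<le> \<bar>t - of_int n\<bar>"
      using abs_int_minus_small_ge[OF st(1), of m] abs_int_minus_small_ge[OF st(2), of n] by linarith+
    ultimately have far_z: "\<bar>of_int m\<bar> * y / (2 * D) \<le> norm (z - w)" "\<bar>of_int n\<bar> / (2 * D) \<le> norm (z - w)"
      using far[of "s - of_int m" "t - of_int n"] by simp_all
    have "norm (1 / (z - w) ^ 2 - 1 / w ^ 2) \<le> (K1 + 8 * D ^ 2) * lattice_weight p"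
    proof (cases "m = 0")
      case False
      \<comment> \<open>The factor \<open>\<eta>\<close> allows \<open>max(1, \<bar>n\<bar>)\<close> in place of \<open>\<bar>n\<bar>\<close>: for \<open>n = 0\<close>, \<open>\<eta> \<le> \<bar>m\<bar> y\<close>.\<close>
      define N where "N = max 1 \<bar>real_of_int n\<bar>"
      define M where "M = max (\<bar>of_int m\<bar> * y) (\<eta> * N)"
      have m: "\<bar>real_of_int m\<bar> \<ge> 1" using False by linarith
      have N: "N \<ge> 1" by (simp add: N_def)
      have "0 < \<eta> * N" using N assms(1) by simp
      then have M: "M > 0" unfolding M_def by linarith
      have \<eta>N: "\<eta> * N \<le> max (\<bar>of_int m\<bar> * y) \<bar>of_int n\<bar>"
      proof (cases "\<bar>real_of_int n\<bar> \<le> 1")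
        case True
        then have "\<eta> * N = 1 * \<eta>" by (simp add: N_def)
        also have "\<dots> \<le> \<bar>of_int m\<bar> * y" using m y assms(1) by (intro mult_mono) auto
        finally show ?thesis by simp
      next
        case False
        then have "\<eta> * N \<le> 1 * \<bar>of_int n\<bar>"
          unfolding N_def using assms(2) by (intro mult_mono) auto
        then show ?thesis by simp
      qed
      then have "M \<le> max (\<bar>of_int m\<bar> * y) \<bar>of_int n\<bar>"
        by (simp add: M_def)
      then have "M / (2 * D) \<le> max (\<bar>of_int m\<bar> * y) \<bar>of_int n\<bar> / (2 * D)"
        using D by (intro divide_right_mono) auto
      then have rho: "M / (2 * D) \<le> norm (z - w)" "M / (2 * D) \<le> norm (- w)"
        using far_z far_w by (auto simp: max_def split: if_splits)
      have norm_z: "norm z \<le> y * Z"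
      proof -
        have "norm z \<le> \<bar>s\<bar> * norm \<tau> + \<bar>t\<bar>"
          unfolding z_def by (rule norm_triangle_le) (simp add: norm_mult)
        also have "norm \<tau> \<le> L + y"
          using cmod_le[of \<tau>] \<tau>(1) y by (simp add: y_def)
        also have "\<bar>s\<bar> * (L + y) + \<bar>t\<bar> \<le> 1 * (L + y) + 1"
          using st assms(3) y by (intro add_mono mult_right_mono) auto
        also have "\<dots> \<le> y * Z"
        proof -
          \<comment> \<open>Every constant is absorbed by \<open>y\<close>, since \<open>y / \<eta> \<ge> 1\<close>.\<close>
          have "L \<le> y * (L / \<eta>)" "1 \<le> y * (1 / \<eta>)"
            using y assms mult_right_mono[OF y(2), of L] by (simp_all add: field_simps)
          then show ?thesis by (simp add: Z_def algebra_simps)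
        qed
        finally show ?thesis using st(1) by (simp add: mult_left_mono)
      qed
      have cube: "\<bar>of_int m\<bar> powr (3 / 2) * N powr (3 / 2) * (y * \<eta> ^ 2) \<le> M ^ 3"
      proof -
        \<comment> \<open>Of \<open>y\<^bsup>3/2\<^esup>\<close> one factor \<open>y\<close> is kept to cancel \<open>\<bar>z\<bar>\<close>; the rest is at least \<open>\<eta>\<^bsup>1/2\<^esup>\<close>.\<close>
        have "y * \<eta> ^ 2 = y * (\<eta> powr (1 / 2) * \<eta> powr (3 / 2))"
          using assms(1) by (simp flip: powr_add add: powr_numeral)
        also have "\<dots> \<le> y * (y powr (1 / 2) * \<eta> powr (3 / 2))"
          using y assms(1) by (intro mult_left_mono mult_right_mono powr_mono2) auto
        also have "\<dots> = y powr (3 / 2) * \<eta> powr (3 / 2)"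
          using y powr_add[of y 1 "1 / 2"] by simp
        finally have "y * \<eta> ^ 2 \<le> y powr (3 / 2) * \<eta> powr (3 / 2)" .
        then have "\<bar>of_int m\<bar> powr (3 / 2) * N powr (3 / 2) * (y * \<eta> ^ 2) \<le>
            \<bar>of_int m\<bar> powr (3 / 2) * N powr (3 / 2) * (y powr (3 / 2) * \<eta> powr (3 / 2))"
          by (intro mult_left_mono) auto
        also have "\<dots> = (\<bar>of_int m\<bar> * y) powr (3 / 2) * (\<eta> * N) powr (3 / 2)"
          using y N assms(1) by (simp add: powr_mult)
        also have "\<dots> \<le> M ^ 3"
          using m y N assms(1) by (intro cube_ge_powr_mult) (auto simp: M_def)
        finally show ?thesis .
      qed
      have pos: "\<bar>real_of_int m\<bar> powr (3 / 2) * N powr (3 / 2) * (y * \<eta> ^ 2) > 0"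
        using m N y assms(1) by simp
      have "norm (1 / (z - w) ^ 2 - 1 / w ^ 2) \<le> 2 * norm (z - w - (- w)) / (M / (2 * D)) ^ 3"
        using norm_diff_inverse_squares_le[OF _ rho] M D by simp
      also have "\<dots> = 16 * D ^ 3 * norm z / M ^ 3"
        by (simp add: power_divide power_mult_distrib)
      also have "\<dots> \<le> 16 * D ^ 3 * (y * Z) / (\<bar>of_int m\<bar> powr (3 / 2) * N powr (3 / 2) * (y * \<eta> ^ 2))"
        using norm_z cube pos D Z y by (intro frac_le mult_left_mono) auto
      also have "\<dots> = K1 * lattice_weight p"
        using y m by (simp add: K1_def mn lattice_weight_eq N_def max_def mult_ac)
      also have "\<dots> \<le> (K1 + 8 * D ^ 2) * lattice_weight p"
        by (intro mult_right_mono lattice_weight_nonneg) auto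
      finally show ?thesis .
    next
      case True
      then have n: "\<bar>real_of_int n\<bar> \<ge> 1" using p mn by auto
      have sq: "norm (1 / v ^ 2) \<le> 4 * D ^ 2 * lattice_weight p" if "\<bar>of_int n\<bar> / (2 * D) \<le> norm v" for v :: complex
      proof -
        have "norm (1 / v ^ 2) = 1 / norm v ^ 2"
          by (simp add: norm_divide norm_power)
        also have "\<dots> \<le> 1 / (\<bar>of_int n\<bar> / (2 * D)) ^ 2"
          using that n D by (intro frac_le power_mono) auto
        also have "\<dots> = 4 * D ^ 2 * (1 / \<bar>of_int n\<bar> ^ 2)"
          by (simp add: power_divide power_mult_distrib)
        also have "\<dots> \<le> 4 * D ^ 2 * lattice_weight p"
        proof (intro mult_left_mono)
          have "\<bar>real_of_int n\<bar> powr (3 / 2) \<le> \<bar>real_of_int n\<bar> powr 2"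
            using n by (intro powr_mono) auto
          then have "1 / \<bar>real_of_int n\<bar> ^ 2 \<le> 1 / \<bar>real_of_int n\<bar> powr (3 / 2)"
            using n by (intro frac_le) (auto simp: powr_numeral)
          then show "1 / \<bar>real_of_int n\<bar> ^ 2 \<le> lattice_weight p"
            using n True by (simp add: mn lattice_weight_eq max_def)
        qed simp
        finally show ?thesis .
      qed
      have "norm (1 / (z - w) ^ 2 - 1 / w ^ 2) \<le> 4 * D ^ 2 * lattice_weight p + 4 * D ^ 2 * lattice_weight p"
        using sq[OF far_z(2)] sq[OF far_w(2)] by (intro norm_triangle_le_diff add_mono) simp_all
      also have "\<dots> \<le> (K1 + 8 * D ^ 2) * lattice_weight p"
        using K1 lattice_weight_nonneg[of p] by (simp add: algebra_simps)
      finally show ?thesis .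
    qed
    then show "norm (1 / (of_real s * \<tau> + of_real t - lattice_point \<tau> p) ^ 2 - 1 / lattice_point \<tau> p ^ 2)
         \<le> (K1 + 8 * D ^ 2) * lattice_weight p"
      by (simp only: z_def w_def)
  qed
qed

section \<open>Holomorphy and boundedness\<close>

text \<open>
  On a small disc around a point of the half plane the series without its term \<open>1/z\<^sup>2\<close> is a uniform
  limit of holomorphic functions. Its summands have no poles there, because \<open>s \<tau> + t\<close> is a lattice
  point only if \<open>s\<close> and \<open>t\<close> are integers.
\<close>

lemma holomorphic_wp_tau_reduced:
  fixes s t :: real
  assumes st: "\<bar>s\<bar> \<le> 1 / 2" "\<bar>t\<bar> \<le> 1 / 2" "(s, t) \<noteq> (0, 0)"
  shows "(\<lambda>\<tau>. wp_tau \<tau> (of_real s * \<tau> + of_real t)) holomorphic_on upper_half_plane"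
proof (rule analytic_imp_holomorphic, unfold analytic_on_def, rule ballI)
  fix \<tau>0 assume "\<tau>0 \<in> upper_half_plane"
  define r where "r = Im \<tau>0 / 2"
  have r: "r > 0" using \<open>\<tau>0 \<in> upper_half_plane\<close> by (simp add: r_def upper_half_plane_def)
  have box: "\<bar>Re \<tau>\<bar> \<le> \<bar>Re \<tau>0\<bar> + r \<and> r \<le> Im \<tau>" if "\<tau> \<in> cball \<tau>0 r" for \<tau>
  proof -
    have "norm (\<tau>0 - \<tau>) \<le> r" using that by (simp add: dist_norm)
    then show ?thesis
      using abs_Re_le_cmod[of "\<tau>0 - \<tau>"] abs_Im_le_cmod[of "\<tau>0 - \<tau>"]
      unfolding r_def minus_complex.simps by linarith
  qed
  then have cball: "cball \<tau>0 r \<subseteq> upper_half_plane"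
    using r by (force simp: upper_half_plane_def)
  have nz: "of_real s * \<tau> + of_real t - lattice_point \<tau> p \<noteq> 0"
    if "\<tau> \<in> upper_half_plane" for \<tau> p
  proof
    assume "of_real s * \<tau> + of_real t - lattice_point \<tau> p = 0"
    moreover obtain m n where "p = (m, n)" by (cases p)
    ultimately have *: "(s - of_int m) * Im \<tau> = 0" "(s - of_int m) * Re \<tau> + (t - of_int n) = 0"
      by (auto simp: lattice_point_def complex_eq_iff algebra_simps)
    then have "s = of_int m" "t = of_int n"
      using that by (auto simp: upper_half_plane_def)
    then have "\<bar>real_of_int m\<bar> \<le> 1 / 2" "\<bar>real_of_int n\<bar> \<le> 1 / 2" using st by auto
    then have "m = 0" "n = 0" by linarith+
    then show False using st(3) \<open>s = _\<close> \<open>t = _\<close> by simp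
  qed
  let ?g = "\<lambda>p \<tau>. 1 / (of_real s * \<tau> + of_real t - lattice_point \<tau> p) ^ 2 - 1 / lattice_point \<tau> p ^ 2"
  have hol: "?g p holomorphic_on upper_half_plane" if "p \<in> - {(0, 0)}" for p
    using that nz lattice_point_eq_0_iff unfolding lattice_point_def
    by (intro holomorphic_intros) auto
  obtain K where K: "\<And>\<tau> s t p. \<bar>Re \<tau>\<bar> \<le> \<bar>Re \<tau>0\<bar> + r \<Longrightarrow> min 1 r \<le> Im \<tau> \<Longrightarrow> \<bar>s\<bar> \<le> 1 / 2 \<Longrightarrow> \<bar>t\<bar> \<le> 1 / 2 \<Longrightarrow>
      p \<noteq> (0, 0) \<Longrightarrow>
      norm (1 / (of_real s * \<tau> + of_real t - lattice_point \<tau> p) ^ 2 - 1 / lattice_point \<tau> p ^ 2)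
         \<le> K * lattice_weight p"
    using weierstrass_term_uniform_bound[of "min 1 r" "\<bar>Re \<tau>0\<bar> + r"] r by auto
  have ulim: "uniform_limit (cball \<tau>0 r) (\<lambda>X \<tau>. \<Sum>p\<in>X. ?g p \<tau>) (\<lambda>\<tau>. \<Sum>\<^sub>\<infinity>p\<in>- {(0, 0)}. ?g p \<tau>)
      (finite_subsets_at_top (- {(0, 0)}))"
  proof (rule Weierstrass_m_test_general)
    show "norm (?g p \<tau>) \<le> K * lattice_weight p" if "p \<in> - {(0, 0)}" "\<tau> \<in> cball \<tau>0 r" for p \<tau>
      using that box[of \<tau>] st by (intro K) auto
    show "(\<lambda>p. K * lattice_weight p) summable_on - {(0, 0)}"
      by (intro summable_on_cmult_right summable_on_subset_banach[OF summable_lattice_weight]) auto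
  qed
  have partial: "\<forall>\<^sub>F X in finite_subsets_at_top (- {(0, 0)}).
      continuous_on (cball \<tau>0 r) (\<lambda>\<tau>. \<Sum>p\<in>X. ?g p \<tau>) \<and> (\<lambda>\<tau>. \<Sum>p\<in>X. ?g p \<tau>) holomorphic_on ball \<tau>0 r"
  proof (rule eventually_finite_subsets_at_top_weakI)
    fix X assume "X \<subseteq> - {(0 :: int, 0 :: int)}"
    then have "(\<lambda>\<tau>. \<Sum>p\<in>X. ?g p \<tau>) holomorphic_on upper_half_plane"
      by (intro holomorphic_on_sum hol) auto
    then have "(\<lambda>\<tau>. \<Sum>p\<in>X. ?g p \<tau>) holomorphic_on cball \<tau>0 r"
      using cball by (rule holomorphic_on_subset)
    then show "continuous_on (cball \<tau>0 r) (\<lambda>\<tau>. \<Sum>p\<in>X. ?g p \<tau>) \<and> (\<lambda>\<tau>. \<Sum>p\<in>X. ?g p \<tau>) holomorphic_on ball \<tau>0 r"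
      by (meson ball_subset_cball holomorphic_on_imp_continuous_on holomorphic_on_subset)
  qed
  have tail: "(\<lambda>\<tau>. \<Sum>\<^sub>\<infinity>p\<in>- {(0, 0)}. ?g p \<tau>) holomorphic_on ball \<tau>0 r"
    by (rule holomorphic_uniform_limit[OF partial ulim finite_subsets_at_top_neq_bot])
  have ball: "\<tau> \<in> upper_half_plane" if "\<tau> \<in> ball \<tau>0 r" for \<tau>
    using that cball ball_subset_cball by blast
  have "of_real s * \<tau> + of_real t \<noteq> 0" if "\<tau> \<in> ball \<tau>0 r" for \<tau>
    using nz[OF ball[OF that], of "(0, 0)"] by (simp add: lattice_point_def)
  then have "(\<lambda>\<tau>. 1 / (of_real s * \<tau> + of_real t) ^ 2 + (\<Sum>\<^sub>\<infinity>p\<in>- {(0, 0)}. ?g p \<tau>)) holomorphic_on ball \<tau>0 r"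
    by (intro holomorphic_intros tail) auto
  then have "(\<lambda>\<tau>. wp_tau \<tau> (of_real s * \<tau> + of_real t)) holomorphic_on ball \<tau>0 r"
    by (rule holomorphic_transform) (simp add: wp_tau_eq_infsum ball)
  then show "\<exists>e>0. (\<lambda>\<tau>. wp_tau \<tau> (of_real s * \<tau> + of_real t)) holomorphic_on ball \<tau>0 e"
    using r by blast
qed

lemma norm_wp_tau_reduced_le:
  fixes L \<eta> :: real
  assumes "0 < \<eta>" "\<eta> \<le> 1" "0 \<le> L"
  obtains B where
    "\<And>\<tau> s t. \<bar>Re \<tau>\<bar> \<le> L \<Longrightarrow> \<eta> \<le> Im \<tau> \<Longrightarrow> \<bar>s\<bar> \<le> 1 / 2 \<Longrightarrow> \<bar>t\<bar> \<le> 1 / 2 \<Longrightarrow>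
       norm (wp_tau \<tau> (of_real s * \<tau> + of_real t)) \<le> 1 / norm (of_real s * \<tau> + of_real t) ^ 2 + B"
proof -
  obtain K where K: "\<And>\<tau> s t p. \<bar>Re \<tau>\<bar> \<le> L \<Longrightarrow> \<eta> \<le> Im \<tau> \<Longrightarrow> \<bar>s\<bar> \<le> 1 / 2 \<Longrightarrow> \<bar>t\<bar> \<le> 1 / 2 \<Longrightarrow> p \<noteq> (0, 0) \<Longrightarrow>
       norm (1 / (of_real s * \<tau> + of_real t - lattice_point \<tau> p) ^ 2 - 1 / lattice_point \<tau> p ^ 2)
         \<le> K * lattice_weight p"
    using weierstrass_term_uniform_bound[OF assms] by blast
  have W: "(\<lambda>p. K * lattice_weight p) summable_on - {(0, 0)}"
    by (intro summable_on_cmult_right summable_on_subset_banach[OF summable_lattice_weight]) auto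
  show ?thesis
  proof (rule that)
    fix \<tau> :: complex and s t :: real
    assume *: "\<bar>Re \<tau>\<bar> \<le> L" "\<eta> \<le> Im \<tau>" "\<bar>s\<bar> \<le> 1 / 2" "\<bar>t\<bar> \<le> 1 / 2"
    then have H: "\<tau> \<in> upper_half_plane" using assms(1) by (simp add: upper_half_plane_def)
    let ?z = "of_real s * \<tau> + of_real t"
    let ?g = "\<lambda>p. 1 / (?z - lattice_point \<tau> p) ^ 2 - 1 / lattice_point \<tau> p ^ 2"
    have "?g summable_on - {(0, 0)}"
      by (rule summable_on_subset_banach[OF summable_weierstrass_terms[OF H]]) auto
    then have "norm (infsum ?g (- {(0, 0)})) \<le> (\<Sum>\<^sub>\<infinity>p\<in>- {(0, 0)}. K * lattice_weight p)"
      by (intro norm_infsum_le[OF has_sum_infsum has_sum_infsum[OF W]]) (use K * in auto)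
    then show "norm (wp_tau \<tau> ?z) \<le> 1 / norm ?z ^ 2 + (\<Sum>\<^sub>\<infinity>p\<in>- {(0, 0)}. K * lattice_weight p)"
      unfolding wp_tau_eq_infsum[OF H]
      by (intro norm_triangle_le add_mono) (simp_all add: norm_divide norm_power)
  qed
qed

lemma wp_tau_translate:
  assumes "\<tau> \<in> upper_half_plane"
  shows "wp_tau (\<tau> + of_int k) z = wp_tau \<tau> z"
  using wp_tau_moebius[of 1 1 k 0 \<tau> z] assms by simp

text \<open>
  After reducing \<open>Re \<tau>\<close>, \<open>s\<close> and \<open>t\<close>, what remains is a lower bound for the norm of the reduced argument.
  If \<open>s\<close> is not an integer, the distance of \<open>s\<close> to the nearest integer bounds the imaginary part away
  from zero. If \<open>s\<close> is an integer, the argument is \<open>t\<close> minus the nearest integer, whatever \<open>\<tau>\<close> is, because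
  integer translations of \<open>\<tau>\<close> then change \<open>t\<close> by integers only.
\<close>

lemma wp_tau_bounded_at_infinity:
  fixes s t :: real
  assumes "\<not> (s \<in> \<int> \<and> t \<in> \<int>)"
  obtains B where "\<And>\<tau>. 1 \<le> Im \<tau> \<Longrightarrow> norm (wp_tau \<tau> (of_real s * \<tau> + of_real t)) \<le> B"
proof -
  define s0 where "s0 = s - of_int (round s)"
  define e where "e = (if s0 = 0 then \<bar>t - of_int (round t)\<bar> else \<bar>s0\<bar>)"
  have e: "e > 0"
    using assms by (auto simp: e_def s0_def) (metis Ints_of_int)+
  obtain B where B: "\<And>\<tau> s t. \<bar>Re \<tau>\<bar> \<le> 1 / 2 \<Longrightarrow> 1 \<le> Im \<tau> \<Longrightarrow> \<bar>s\<bar> \<le> 1 / 2 \<Longrightarrow> \<bar>t\<bar> \<le> 1 / 2 \<Longrightarrow>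
       norm (wp_tau \<tau> (of_real s * \<tau> + of_real t)) \<le> 1 / norm (of_real s * \<tau> + of_real t) ^ 2 + B"
    using norm_wp_tau_reduced_le[of 1 "1 / 2"] by auto
  show ?thesis
  proof (rule that)
    fix \<tau> :: complex assume \<tau>: "1 \<le> Im \<tau>"
    define k where "k = round (Re \<tau>)"
    define \<tau>' where "\<tau>' = \<tau> - of_int k"
    define t1 where "t1 = s * of_int k + t"
    define t0 where "t0 = t1 - of_int (round t1)"
    have \<tau>': "\<bar>Re \<tau>'\<bar> \<le> 1 / 2" "1 \<le> Im \<tau>'" "\<tau>' \<in> upper_half_plane"
      using \<tau> of_int_round_abs_le[of "Re \<tau>"]
      by (auto simp: \<tau>'_def k_def upper_half_plane_def abs_minus_commute)
    have st0: "\<bar>s0\<bar> \<le> 1 / 2" "\<bar>t0\<bar> \<le> 1 / 2"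
      using of_int_round_abs_le[of s] of_int_round_abs_le[of t1]
      by (simp_all add: s0_def t0_def abs_minus_commute)
    have "of_real s * \<tau> + of_real t =
        (of_real s0 * \<tau>' + of_real t0) + of_int (round s) * \<tau>' + of_int (round t1)"
      by (simp add: s0_def t0_def t1_def \<tau>'_def algebra_simps)
    then have "wp_tau \<tau> (of_real s * \<tau> + of_real t) = wp_tau \<tau>' (of_real s0 * \<tau>' + of_real t0)"
      using wp_tau_translate[OF \<tau>'(3), of k] wp_tau_periodic[OF \<tau>'(3)] by (simp add: \<tau>'_def)
    also have "norm \<dots> \<le> 1 / norm (of_real s0 * \<tau>' + of_real t0) ^ 2 + B"
      by (intro B \<tau>' st0)
    also have "\<dots> \<le> 1 / e ^ 2 + B"
    proof -
      have "e \<le> norm (of_real s0 * \<tau>' + of_real t0)"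
      proof (cases "s0 = 0")
        case True
        then have "s * of_int k = of_int (round s * k)" by (simp add: s0_def)
        then have "t0 = t - of_int (round t)"
          by (simp only: t0_def t1_def) (simp add: round_def add.assoc flip: of_int_mult)
        then show ?thesis
          using True by (simp add: e_def del: of_real_diff)
      next
        case False
        have "\<bar>s0\<bar> * 1 \<le> \<bar>s0\<bar> * Im \<tau>'"
          using \<tau>'(2) by (intro mult_left_mono) auto
        also have "\<dots> \<le> norm (of_real s0 * \<tau>' + of_real t0)"
          using \<tau>' by (intro norm_lattice_combination_ge(1)[of _ "1 / 2" 1]) auto
        finally show ?thesis using False by (simp add: e_def)
      qed
      then show ?thesis
        using e by (intro add_right_mono frac_le power_mono) auto
    qed
    finally show "norm (wp_tau \<tau> (of_real s * \<tau> + of_real t)) \<le> 1 / e ^ 2 + B" .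
  qed
qed

section \<open>Division values\<close>

lemma of_real_of_rat: "of_real (of_rat q) = (of_rat q :: 'a :: {real_div_algebra, field_char_0})"
proof (cases q)
  case (Fract a b)
  then show ?thesis by (simp add: of_rat_rat)
qed

lemma division_value_of_real:
  "division_value (s, t) \<tau> = wp_tau \<tau> (of_real (of_rat s) * \<tau> + of_real (of_rat t))"
  by (simp add: division_value_def of_real_of_rat)

lemma division_value_cong:
  assumes "v - w \<in> \<int> \<times> \<int>" "\<tau> \<in> upper_half_plane"
  shows "division_value v \<tau> = division_value w \<tau>"
proof -
  obtain m n where "fst v - fst w = of_int m" "snd v - snd w = of_int n"
    using assms(1) by (auto elim!: Ints_cases simp: mem_Times_iff)
  then have "fst v = fst w + of_int m" "snd v = snd w + of_int n"
    by (simp_all add: algebra_simps)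
  then have "of_rat (fst v) * \<tau> + of_rat (snd v) =
      (of_rat (fst w) * \<tau> + of_rat (snd w)) + of_int m * \<tau> + of_int n"
    by (simp add: of_rat_add algebra_simps)
  then show ?thesis
    using wp_tau_periodic[OF assms(2)] by (simp add: division_value_def)
qed

text \<open>
  With \<open>v = (s, t)\<close>, the point \<open>s A\<tau> + t\<close> is \<open>(s (a \<tau> + b) + t (c \<tau> + d)) / (c \<tau> + d)\<close>, and its numerator is
  the argument belonging to \<open>v A\<close>. The factor \<open>(c \<tau> + d)\<^sup>2\<close> from homogeneity cancels the weight.
\<close>

lemma slash_division_value:
  assumes "A \<in> SL2Z" "\<tau> \<in> upper_half_plane"
  shows "slash 2 A (division_value v) \<tau> = division_value (row_times v A) \<tau>"
proof -
  define a b c d where abcd: "a = A $ 1 $ 1" "b = A $ 1 $ 2" "c = A $ 2 $ 1" "d = A $ 2 $ 2"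
  have det: "a * d - b * c = 1"
    using assms(1) by (simp add: SL2Z_def det_2 abcd)
  define j where "j = of_int c * \<tau> + of_int d"
  have j: "j \<noteq> 0"
    unfolding j_def by (rule automorphy_factor_nonzero[OF det assms(2)])
  let ?z = "of_rat (fst (row_times v A)) * \<tau> + of_rat (snd (row_times v A))"
  have "of_rat (fst v) * ((of_int a * \<tau> + of_int b) / j) + of_rat (snd v) = ?z / j"
    using j by (simp add: field_simps row_times_def of_rat_add of_rat_mult flip: abcd) 
      (simp add: j_def algebra_simps)
  then have "slash 2 A (division_value v) \<tau> = j powi - 2 * wp_tau ((of_int a * \<tau> + of_int b) / j) (?z / j)"
    by (simp add: slash_def division_value_def j_def flip: abcd)
  also have "\<dots> = j powi - 2 * (j ^ 2 * wp_tau \<tau> ?z)"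
    unfolding j_def by (simp only: wp_tau_moebius[OF det assms(2)])
  also have "\<dots> = wp_tau \<tau> ?z"
    using j by (simp add: power_int_minus)
  finally show ?thesis
    by (simp add: division_value_def)
qed

text \<open>
  Multiplying by the inverse matrix, which is again integral.
\<close>

lemma row_times_integral_imp:
  assumes "A \<in> SL2Z" "row_times v A \<in> \<int> \<times> \<int>"
  shows "v \<in> \<int> \<times> \<int>"
proof -
  define a b c d where abcd: "a = A $ 1 $ 1" "b = A $ 1 $ 2" "c = A $ 2 $ 1" "d = A $ 2 $ 2"
  obtain s t where v: "v = (s, t)" by (cases v)
  have "a * d - b * c = 1"
    using assms(1) by (simp add: SL2Z_def det_2 abcd)
  then have det: "rat_of_int a * of_int d - of_int b * of_int c = 1"
    by (metis of_int_1 of_int_diff of_int_mult)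
  define s' t' where "s' = s * of_int a + t * of_int c" and "t' = s * of_int b + t * of_int d"
  have st: "s' \<in> \<int>" "t' \<in> \<int>"
    using assms(2) by (simp_all add: row_times_def v s'_def t'_def abcd)
  have "s = s * (of_int a * of_int d - of_int b * of_int c)" "t = t * (of_int a * of_int d - of_int b * of_int c)"
    by (simp_all add: det)
  then have "s = s' * of_int d - t' * of_int c" "t = t' * of_int a - s' * of_int b"
    by (simp_all add: s'_def t'_def algebra_simps)
  then have "s \<in> \<int>" "t \<in> \<int>"
    using st by simp_all
  then show ?thesis by (simp add: v)
qed

lemma Ints_of_rat_real_iff: "real_of_rat q \<in> \<int> \<longleftrightarrow> q \<in> \<int>"
  by (metis Ints_cases Ints_of_int of_rat_eq_iff of_rat_of_int_eq)

theorem theorem2: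
  fixes s t :: rat
  assumes "(s, t) \<notin> \<int> \<times> \<int>"
  shows "modular_form 2 (Gamma_vec (s, t)) (division_value (s, t))"
  unfolding modular_form_def
proof (intro conjI ballI)
  define s0 t0 where st0: "s0 = real_of_rat s - of_int (round (real_of_rat s))" "t0 = real_of_rat t - of_int (round (real_of_rat t))"
  have "\<bar>s0\<bar> \<le> 1 / 2" "\<bar>t0\<bar> \<le> 1 / 2"
    using of_int_round_abs_le[of "real_of_rat s"] of_int_round_abs_le[of "real_of_rat t"]
    by (simp_all add: st0 abs_minus_commute)
  moreover have "(s0, t0) \<noteq> (0, 0)"
  proof
    assume "(s0, t0) = (0, 0)"
    then have "real_of_rat s = of_int (round (real_of_rat s))"
      "real_of_rat t = of_int (round (real_of_rat t))"
      by (simp_all add: st0)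
    then have "real_of_rat s \<in> \<int>" "real_of_rat t \<in> \<int>"
      by (metis Ints_of_int)+
    then show False using assms by (simp add: Ints_of_rat_real_iff)
  qed
  ultimately have "(\<lambda>\<tau>. wp_tau \<tau> (of_real s0 * \<tau> + of_real t0)) holomorphic_on upper_half_plane"
    by (rule holomorphic_wp_tau_reduced)
  moreover have "wp_tau \<tau> (of_real s0 * \<tau> + of_real t0) = division_value (s, t) \<tau>"
    if "\<tau> \<in> upper_half_plane" for \<tau>
  proof -
    have "of_real (of_rat s) * \<tau> + of_real (of_rat t) = (of_real s0 * \<tau> + of_real t0) +
        of_int (round (real_of_rat s)) * \<tau> + of_int (round (real_of_rat t))"
      by (simp add: st0 algebra_simps)
    then show ?thesis
      using wp_tau_periodic[OF that] by (simp only: division_value_of_real)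
  qed
  ultimately show "division_value (s, t) holomorphic_on upper_half_plane"
    by (rule holomorphic_transform)
next
  fix A \<tau> assume A: "A \<in> Gamma_vec (s, t)" and \<tau>: "\<tau> \<in> upper_half_plane"
  then show "slash 2 A (division_value (s, t)) \<tau> = division_value (s, t) \<tau>"
    using slash_division_value[of A \<tau>] division_value_cong[of _ "(s, t)" \<tau>]
    by (simp add: Gamma_vec_def)
next
  fix A assume A: "A \<in> SL2Z"
  obtain s' t' where v: "row_times (s, t) A = (s', t')" by (cases "row_times (s, t) A")
  have "(s', t') \<notin> \<int> \<times> \<int>"
    using row_times_integral_imp[OF A, of "(s, t)"] assms v by metis
  then have "\<not> (real_of_rat s' \<in> \<int> \<and> real_of_rat t' \<in> \<int>)"
    by (simp add: Ints_of_rat_real_iff)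
  then obtain B where "\<And>\<tau>. 1 \<le> Im \<tau> \<Longrightarrow> norm (division_value (s', t') \<tau>) \<le> B"
    unfolding division_value_of_real by (rule wp_tau_bounded_at_infinity) blast
  then have "norm (slash 2 A (division_value (s, t)) \<tau>) \<le> B" if "Im \<tau> > 1" for \<tau>
    using slash_division_value[OF A, of \<tau> "(s, t)"] that v by (simp add: upper_half_plane_def)
  then show "\<exists>C>0. bounded (slash 2 A (division_value (s, t)) ` {\<tau>. Im \<tau> > C})"
    by (intro exI[of _ 1]) (auto simp: bounded_iff)
qed

end
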